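(* Let $\mathcal{A}$ be an additive category. Then the categories $G(\mathcal{A})$ and $C(\mathbb{Z}_+\mathcal{A})$ are isomorphic.
   Context: The category $G(\mathcal{A})$ (Rickard): objects are systems $\{X^{**},d_n\colon n=0,1,\dots\}$, where $X^{**}$ is a ($\mathbb{Z}\times\mathbb{Z}$-)bigraded object of $\mathcal{A}$ and $d_n$ is a graded endomorphism of $X^{**}$ of degree $(1-n,n)$, satisfying $d_0d_n+d_1d_{n-1}+\cdots+d_nd_0=0$ for all $n\ge0$. A morphism from $\{X^{**},d_{X,n}\}$ to $\{Y^{**},d_{Y,n}\}$ is a collection $\alpha=\{\alpha_n\colon n\ge0\}$ of graded maps $X^{**}\to Y^{**}$ with $\alpha_n$ of degree $(-n,n)$ and $\alpha_0d_{X,n}+\alpha_1d_{X,n-1}+\cdots+\alpha_nd_{X,0}=d_{Y,0}\alpha_n+d_{Y,1}\alpha_{n-1}+\cdots+d_{Y,n}\alpha_0$ for each $n$. Composition is $(\alpha\beta)_n=\alpha_0\beta_n+\alpha_1\beta_{n-1}+\cdots+\alpha_n\beta_0$. The category $\mathbb{Z}_+\mathcal{A}$: objects are $\mathbb{Z}$-graded objects $X^\bullet=(X^j)_{j\in\mathbb{Z}}$ with $X^j\in\mathcal{A}$; a morphism $X^\bullet\to Y^\bullet$ is a collection $f=\{f_0,f_1,\dots,f_n,\dots\}$ where $f_n$ has degree $n$, i.e. consists of morphisms $f_n^j\colon X^j\to Y^{j+n}$ in $\mathcal{A}$ for $j\in\mathbb{Z}$, $n\ge0$; the composition is $(gf)_n^j=g_n^jf_0^j+g_{n-1}^{j+1}f_1^j+\cdots+g_0^{j+n}f_n^j$,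 and identities are $\{\mathrm{Id},0,0,\dots\}$. $C(\mathbb{Z}_+\mathcal{A})$ is the category of (unbounded) complexes in $\mathbb{Z}_+\mathcal{A}$. *)

theory Defs
  imports Main "HOL-Algebra.FiniteProduct"
begin

text \<open>
  Categories are given by a class of objects and a family of hom-sets indexed by pairs of objects.
  Hom-sets need not be disjoint, so composition, and the action of a functor on morphisms, take
  the relevant objects as arguments: \<open>Comp C X Y Z g f\<close> is the composite of \<open>f : X \<rightarrow> Y\<close>
  followed by \<open>g : Y \<rightarrow> Z\<close>.
\<close>

record ('o, 'm) cat =
  Ob :: "'o set"
  Hom :: "'o \<Rightarrow> 'o \<Rightarrow> 'm set"
  Comp :: "'o \<Rightarrow> 'o \<Rightarrow> 'o \<Rightarrow> 'm \<Rightarrow> 'm \<Rightarrow> 'm"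
  Id :: "'o \<Rightarrow> 'm"

locale category =
  fixes C :: "('o, 'm, 'z) cat_scheme"
  assumes Comp_in_Hom:
    "\<lbrakk>X \<in> Ob C; Y \<in> Ob C; Z \<in> Ob C; f \<in> Hom C X Y; g \<in> Hom C Y Z\<rbrakk>
      \<Longrightarrow> Comp C X Y Z g f \<in> Hom C X Z"
    and Id_in_Hom: "X \<in> Ob C \<Longrightarrow> Id C X \<in> Hom C X X"
    and Comp_Id: "\<lbrakk>X \<in> Ob C; Y \<in> Ob C; f \<in> Hom C X Y\<rbrakk> \<Longrightarrow> Comp C X X Y f (Id C X) = f"
    and Id_Comp: "\<lbrakk>X \<in> Ob C; Y \<in> Ob C; f \<in> Hom C X Y\<rbrakk> \<Longrightarrow> Comp C X Y Y (Id C Y) f = f"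
    and Comp_assoc:
    "\<lbrakk>W \<in> Ob C; X \<in> Ob C; Y \<in> Ob C; Z \<in> Ob C;
      f \<in> Hom C W X; g \<in> Hom C X Y; h \<in> Hom C Y Z\<rbrakk>
      \<Longrightarrow> Comp C W Y Z h (Comp C W X Y g f) = Comp C W X Z (Comp C X Y Z h g) f"

locale cat_functor = C: category C + D: category D
  for C :: "('o1, 'm1, 'z1) cat_scheme" and D :: "('o2, 'm2, 'z2) cat_scheme" +
  fixes Fo :: "'o1 \<Rightarrow> 'o2" and Fm :: "'o1 \<Rightarrow> 'o1 \<Rightarrow> 'm1 \<Rightarrow> 'm2"
  assumes Fo_in_Ob: "X \<in> Ob C \<Longrightarrow> Fo X \<in> Ob D"
    and Fm_in_Hom:
    "\<lbrakk>X \<in> Ob C; Y \<in> Ob C; f \<in> Hom C X Y\<rbrakk> \<Longrightarrow> Fm X Y f \<in> Hom D (Fo X) (Fo Y)"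
    and Fm_Id: "X \<in> Ob C \<Longrightarrow> Fm X X (Id C X) = Id D (Fo X)"
    and Fm_Comp:
    "\<lbrakk>X \<in> Ob C; Y \<in> Ob C; Z \<in> Ob C; f \<in> Hom C X Y; g \<in> Hom C Y Z\<rbrakk>
      \<Longrightarrow> Fm X Z (Comp C X Y Z g f) = Comp D (Fo X) (Fo Y) (Fo Z) (Fm Y Z g) (Fm X Y f)"

text \<open>
  Isomorphism (not merely equivalence) of categories: there are functors in both directions whose
  composites are equal to the identity functors.  That both sides are categories is part of
  \<^const>\<open>cat_functor\<close>.
\<close>

definition isomorphic_categories ::
  "('o1, 'm1, 'z1) cat_scheme \<Rightarrow> ('o2, 'm2, 'z2) cat_scheme \<Rightarrow> bool" where
  "isomorphic_categories C D \<longleftrightarrow>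
    (\<exists>Fo Fm Go Gm.
      cat_functor C D Fo Fm \<and> cat_functor D C Go Gm \<and>
      (\<forall>X\<in>Ob C. Go (Fo X) = X) \<and>
      (\<forall>X\<in>Ob C. \<forall>Y\<in>Ob C. \<forall>f\<in>Hom C X Y. Gm (Fo X) (Fo Y) (Fm X Y f) = f) \<and>
      (\<forall>X\<in>Ob D. Fo (Go X) = X) \<and>
      (\<forall>X\<in>Ob D. \<forall>Y\<in>Ob D. \<forall>f\<in>Hom D X Y. Fm (Go X) (Go Y) (Gm X Y f) = f))"

record ('o, 'm) ab_cat = "('o, 'm) cat" +
  Zero :: "'o \<Rightarrow> 'o \<Rightarrow> 'm"
  Add :: "'o \<Rightarrow> 'o \<Rightarrow> 'm \<Rightarrow> 'm \<Rightarrow> 'm"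

definition hom_group :: "('o, 'm, 'z) ab_cat_scheme \<Rightarrow> 'o \<Rightarrow> 'o \<Rightarrow> 'm monoid" where
  "hom_group C X Y = \<lparr>carrier = Hom C X Y, mult = Add C X Y, one = Zero C X Y\<rparr>"

text \<open>
  The group of morphisms \<open>X \<rightarrow> Y\<close> is additive but is represented by a monoid record, so
  \<^const>\<open>finprod\<close> in it is a finite sum of morphisms: \<open>hom_sum C X Y t n = t 0 + \<dots> + t n\<close>.
\<close>

definition hom_sum ::
  "('o, 'm, 'z) ab_cat_scheme \<Rightarrow> 'o \<Rightarrow> 'o \<Rightarrow> (nat \<Rightarrow> 'm) \<Rightarrow> nat \<Rightarrow> 'm" where
  "hom_sum C X Y t n = finprod (hom_group C X Y) t {..n}"

locale preadditive_category = category C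
  for C :: "('o, 'm, 'z) ab_cat_scheme" +
  assumes comm_group_hom: "\<lbrakk>X \<in> Ob C; Y \<in> Ob C\<rbrakk> \<Longrightarrow> comm_group (hom_group C X Y)"
    and Comp_Add_right:
    "\<lbrakk>X \<in> Ob C; Y \<in> Ob C; Z \<in> Ob C; f \<in> Hom C X Y; f' \<in> Hom C X Y; g \<in> Hom C Y Z\<rbrakk>
      \<Longrightarrow> Comp C X Y Z g (Add C X Y f f') = Add C X Z (Comp C X Y Z g f) (Comp C X Y Z g f')"
    and Comp_Add_left:
    "\<lbrakk>X \<in> Ob C; Y \<in> Ob C; Z \<in> Ob C; f \<in> Hom C X Y; g \<in> Hom C Y Z; g' \<in> Hom C Y Z\<rbrakk>
      \<Longrightarrow> Comp C X Y Z (Add C Y Z g g') f = Add C X Z (Comp C X Y Z g f) (Comp C X Y Z g' f)"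

definition zero_object :: "('o, 'm, 'z) cat_scheme \<Rightarrow> 'o \<Rightarrow> bool" where
  "zero_object C O' \<longleftrightarrow> O' \<in> Ob C \<and> (\<forall>X\<in>Ob C. (\<exists>!f. f \<in> Hom C O' X) \<and> (\<exists>!f. f \<in> Hom C X O'))"

definition is_biproduct ::
  "('o, 'm, 'z) ab_cat_scheme \<Rightarrow> 'o \<Rightarrow> 'o \<Rightarrow> 'o \<Rightarrow> 'm \<Rightarrow> 'm \<Rightarrow> 'm \<Rightarrow> 'm \<Rightarrow> bool" where
  "is_biproduct C X Y S i1 i2 p1 p2 \<longleftrightarrow>
    S \<in> Ob C \<and>
    i1 \<in> Hom C X S \<and> i2 \<in> Hom C Y S \<and> p1 \<in> Hom C S X \<and> p2 \<in> Hom C S Y \<and>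
    Comp C X S X p1 i1 = Id C X \<and> Comp C Y S Y p2 i2 = Id C Y \<and>
    Comp C X S Y p2 i1 = Zero C X Y \<and> Comp C Y S X p1 i2 = Zero C Y X \<and>
    Add C S S (Comp C S X S i1 p1) (Comp C S Y S i2 p2) = Id C S"

locale additive_category = preadditive_category C
  for C :: "('o, 'm, 'z) ab_cat_scheme" +
  assumes ex_zero_object: "\<exists>O'. zero_object C O'"
    and ex_biproduct:
    "\<lbrakk>X \<in> Ob C; Y \<in> Ob C\<rbrakk> \<Longrightarrow> \<exists>S i1 i2 p1 p2. is_biproduct C X Y S i1 i2 p1 p2"

text \<open>
  The category \<open>G(A)\<close>.  An object is a pair \<open>(X, d)\<close> of a bigraded object, with \<open>X p q\<close> in
  bidegree \<open>(p, q)\<close>, and maps \<open>d n p q : X p q \<rightarrow> X (p + 1 - n) (q + n)\<close>.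
\<close>

type_synonym ('o, 'm) G_obj = "(int \<Rightarrow> int \<Rightarrow> 'o) \<times> (nat \<Rightarrow> int \<Rightarrow> int \<Rightarrow> 'm)"
type_synonym 'm G_mor = "nat \<Rightarrow> int \<Rightarrow> int \<Rightarrow> 'm"

definition G_Ob :: "('o, 'm, 'z) ab_cat_scheme \<Rightarrow> ('o, 'm) G_obj set" where
  "G_Ob A = {(X, d).
    (\<forall>p q. X p q \<in> Ob A) \<and>
    (\<forall>n p q. d n p q \<in> Hom A (X p q) (X (p + 1 - int n) (q + int n))) \<and>
    (\<forall>n p q.
      hom_sum A (X p q) (X (p + 2 - int n) (q + int n))
        (\<lambda>k. Comp A (X p q) (X (p + 1 - int (n - k)) (q + int (n - k)))
                (X (p + 2 - int n) (q + int n))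
                (d k (p + 1 - int (n - k)) (q + int (n - k))) (d (n - k) p q)) n
      = Zero A (X p q) (X (p + 2 - int n) (q + int n)))}"

definition G_Hom ::
  "('o, 'm, 'z) ab_cat_scheme \<Rightarrow> ('o, 'm) G_obj \<Rightarrow> ('o, 'm) G_obj \<Rightarrow> 'm G_mor set" where
  "G_Hom A = (\<lambda>(X, dX) (Y, dY). {\<alpha>.
    (\<forall>n p q. \<alpha> n p q \<in> Hom A (X p q) (Y (p - int n) (q + int n))) \<and>
    (\<forall>n p q.
      hom_sum A (X p q) (Y (p + 1 - int n) (q + int n))
        (\<lambda>k. Comp A (X p q) (X (p + 1 - int (n - k)) (q + int (n - k)))
                (Y (p + 1 - int n) (q + int n))
                (\<alpha> k (p + 1 - int (n - k)) (q + int (n - k))) (dX (n - k) p q)) n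
      = hom_sum A (X p q) (Y (p + 1 - int n) (q + int n))
        (\<lambda>k. Comp A (X p q) (Y (p - int (n - k)) (q + int (n - k)))
                (Y (p + 1 - int n) (q + int n))
                (dY k (p - int (n - k)) (q + int (n - k))) (\<alpha> (n - k) p q)) n)})"

definition G_Comp ::
  "('o, 'm, 'z) ab_cat_scheme \<Rightarrow> ('o, 'm) G_obj \<Rightarrow> ('o, 'm) G_obj \<Rightarrow> ('o, 'm) G_obj
    \<Rightarrow> 'm G_mor \<Rightarrow> 'm G_mor \<Rightarrow> 'm G_mor" where
  "G_Comp A = (\<lambda>(X, dX) (Y, dY) (Z, dZ) \<alpha> \<beta> n p q.
    hom_sum A (X p q) (Z (p - int n) (q + int n))
      (\<lambda>k. Comp A (X p q) (Y (p - int (n - k)) (q + int (n - k))) (Z (p - int n) (q + int n))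
              (\<alpha> k (p - int (n - k)) (q + int (n - k))) (\<beta> (n - k) p q)) n)"

definition G_Id :: "('o, 'm, 'z) ab_cat_scheme \<Rightarrow> ('o, 'm) G_obj \<Rightarrow> 'm G_mor" where
  "G_Id A = (\<lambda>(X, d) n p q.
    if n = 0 then Id A (X p q) else Zero A (X p q) (X (p - int n) (q + int n)))"

definition G_cat :: "('o, 'm, 'z) ab_cat_scheme \<Rightarrow> (('o, 'm) G_obj, 'm G_mor) cat" where
  "G_cat A = \<lparr>Ob = G_Ob A, Hom = G_Hom A, Comp = G_Comp A, Id = G_Id A\<rparr>"

text \<open>
  The category \<open>\<int>\<^sub>+A\<close>.  A morphism \<open>f\<close> has components \<open>f n j : X j \<rightarrow> Y (j + n)\<close>; morphisms are
  added componentwise.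
\<close>

definition Zplus ::
  "('o, 'm, 'z) ab_cat_scheme \<Rightarrow> (int \<Rightarrow> 'o, nat \<Rightarrow> int \<Rightarrow> 'm) ab_cat" where
  "Zplus A =
    \<lparr>Ob = {X. \<forall>j. X j \<in> Ob A},
     Hom = (\<lambda>X Y. {f. \<forall>n j. f n j \<in> Hom A (X j) (Y (j + int n))}),
     Comp = (\<lambda>X Y Z g f n j.
       hom_sum A (X j) (Z (j + int n))
         (\<lambda>k. Comp A (X j) (Y (j + int k)) (Z (j + int n)) (g (n - k) (j + int k)) (f k j)) n),
     Id = (\<lambda>X n j. if n = 0 then Id A (X j) else Zero A (X j) (X (j + int n))),
     Zero = (\<lambda>X Y n j. Zero A (X j) (Y (j + int n))),
     Add = (\<lambda>X Y f g n j. Add A (X j) (Y (j + int n)) (f n j) (g n j))\<rparr>"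

text \<open>
  Unbounded cochain complexes \<open>(X, d)\<close> with \<open>d i : X i \<rightarrow> X (i + 1)\<close>, and chain maps.
\<close>

type_synonym ('o, 'm) cplx = "(int \<Rightarrow> 'o) \<times> (int \<Rightarrow> 'm)"

definition Cplx_cat ::
  "('o, 'm, 'z) ab_cat_scheme \<Rightarrow> (('o, 'm) cplx, int \<Rightarrow> 'm) cat" where
  "Cplx_cat B =
    \<lparr>Ob = {(X, d).
       (\<forall>i. X i \<in> Ob B) \<and>
       (\<forall>i. d i \<in> Hom B (X i) (X (i + 1))) \<and>
       (\<forall>i. Comp B (X i) (X (i + 1)) (X (i + 2)) (d (i + 1)) (d i) = Zero B (X i) (X (i + 2)))},
     Hom = (\<lambda>(X, dX) (Y, dY). {f.
       (\<forall>i. f i \<in> Hom B (X i) (Y i)) \<and>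
       (\<forall>i. Comp B (X i) (X (i + 1)) (Y (i + 1)) (f (i + 1)) (dX i)
          = Comp B (X i) (Y i) (Y (i + 1)) (dY i) (f i))}),
     Comp = (\<lambda>(X, dX) (Y, dY) (Z, dZ) g f i. Comp B (X i) (Y i) (Z i) (g i) (f i)),
     Id = (\<lambda>(X, d) i. Id B (X i))\<rparr>"

end

theory Submission
  imports Defs
begin

text \<open>
  Both sides consist of the same data with different indices.  Along a line of constant total
  degree \<open>i = p + q\<close>, the first index of a bigraded object is determined by the second one, so
  the object with entry \<open>X p q\<close> in bidegree \<open>(p, q)\<close> is the same as the family, over \<open>i\<close>, of
  graded objects \<open>j \<mapsto> X (i - j) j\<close>.  A component of bidegree \<open>(s - n, n)\<close> then raises the
  total degree by \<open>s\<close> and the inner degree \<open>j\<close> by \<open>n\<close>.  Thus the components \<open>n \<ge> 0\<close> of a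
  differential (\<open>s = 1\<close>) or of a morphism (\<open>s = 0\<close>) form, for each \<open>i\<close>, a single morphism of
  \<open>\<int>\<^sub>+A\<close> from degree \<open>i\<close> to degree \<open>i + s\<close>.

  Under this relabelling, the convolution sums that express \<open>d\<^sup>2 = 0\<close>, compatibility with the
  differentials and composition in \<open>G(A)\<close> are all instances of composition in \<open>\<int>\<^sub>+A\<close>; the
  single computation is \<open>Comp_Zplus_by_total_degree\<close>, where the only difference left is the order
  of the summands, which does not matter because hom-sets are commutative groups.

  Hence the relabelling is bijective on objects and morphisms and respects identities and
  composition.  The category axioms for \<open>G(A)\<close> need no separate verification: they are transported
  along the relabelling (\<open>isomorphic_categories_relabelling\<close>) from complexes in \<open>\<int>\<^sub>+A\<close>, which form
  a category because \<open>\<int>\<^sub>+A\<close> does.  For the latter the one substantial point is associativity, where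
  both triple composites are sums of \<open>h \<circ> g \<circ> f\<close> over all ways of splitting the degree into three
  parts (\<open>hom_sum_triangle\<close>).
\<close>

section \<open>Transport of a category structure\<close>

text \<open>
  Since membership in the hom-sets is assumed to be reflected by \<open>Fm\<close>, closure under composition
  pulls back along with the equational axioms, and \<open>C\<close> need not be known to be a category in
  advance.
\<close>

lemma isomorphic_categories_relabelling:
  fixes C :: "('o1, 'm1, 'z1) cat_scheme" and D :: "('o2, 'm2, 'z2) cat_scheme"
  assumes D: "category D"
    and bijo: "bij Fo" and bijm: "bij Fm"
    and Ob: "\<And>X. Fo X \<in> Ob D \<longleftrightarrow> X \<in> Ob C"
    and Hom: "\<And>X Y f. \<lbrakk>X \<in> Ob C; Y \<in> Ob C\<rbrakk>
      \<Longrightarrow> Fm f \<in> Hom D (Fo X) (Fo Y) \<longleftrightarrow> f \<in> Hom C X Y"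
    and Id: "\<And>X. X \<in> Ob C \<Longrightarrow> Fm (Id C X) = Id D (Fo X)"
    and Comp: "\<And>X Y Z f g. \<lbrakk>X \<in> Ob C; Y \<in> Ob C; Z \<in> Ob C; f \<in> Hom C X Y; g \<in> Hom C Y Z\<rbrakk>
      \<Longrightarrow> Fm (Comp C X Y Z g f) = Comp D (Fo X) (Fo Y) (Fo Z) (Fm g) (Fm f)"
  shows "isomorphic_categories C D"
proof -
  interpret D: category D by (fact D)
  have inj: "f = g" if "Fm f = Fm g" for f g
    using that bijm by (simp add: bij_is_inj inj_eq)
  have CompC: "Comp C X Y Z g f \<in> Hom C X Z"
    if "X \<in> Ob C" "Y \<in> Ob C" "Z \<in> Ob C" "f \<in> Hom C X Y" "g \<in> Hom C Y Z" for X Y Z f g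
    using that by (simp flip: Hom add: Comp) (simp add: D.Comp_in_Hom Ob Hom)
  have IdC: "Id C X \<in> Hom C X X" if "X \<in> Ob C" for X
    using that by (simp flip: Hom add: Id) (simp add: D.Id_in_Hom Ob)
  interpret C: category C
  proof
    fix X Y Z f g assume "X \<in> Ob C" "Y \<in> Ob C" "Z \<in> Ob C" "f \<in> Hom C X Y" "g \<in> Hom C Y Z"
    then show "Comp C X Y Z g f \<in> Hom C X Z" by (rule CompC)
  next
    fix X assume "X \<in> Ob C"
    then show "Id C X \<in> Hom C X X" by (rule IdC)
  next
    fix X Y f assume "X \<in> Ob C" "Y \<in> Ob C" "f \<in> Hom C X Y"
    then show "Comp C X X Y f (Id C X) = f"
      by (intro inj) (simp add: Comp IdC Id D.Comp_Id Ob Hom)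
  next
    fix X Y f assume "X \<in> Ob C" "Y \<in> Ob C" "f \<in> Hom C X Y"
    then show "Comp C X Y Y (Id C Y) f = f"
      by (intro inj) (simp add: Comp IdC Id D.Id_Comp Ob Hom)
  next
    fix W X Y Z f g h
    assume "W \<in> Ob C" "X \<in> Ob C" "Y \<in> Ob C" "Z \<in> Ob C"
      "f \<in> Hom C W X" "g \<in> Hom C X Y" "h \<in> Hom C Y Z"
    then show "Comp C W Y Z h (Comp C W X Y g f) = Comp C W X Z (Comp C X Y Z h g) f"
      by (intro inj) (simp add: Comp CompC D.Comp_assoc Ob Hom)
  qed
  define Go where "Go = inv_into UNIV Fo"
  define Gm where "Gm = inv_into UNIV Fm"
  have Fo_Go [simp]: "Fo (Go Y) = Y" and Go_Fo [simp]: "Go (Fo X) = X" for X Y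
    using bijo by (simp_all add: Go_def bij_is_surj surj_f_inv_f bij_is_inj)
  have Fm_Gm [simp]: "Fm (Gm g) = g" and Gm_Fm [simp]: "Gm (Fm f) = f" for f g
    using bijm by (simp_all add: Gm_def bij_is_surj surj_f_inv_f bij_is_inj)
  have GoOb: "Go Y \<in> Ob C" if "Y \<in> Ob D" for Y
    using that by (simp flip: Ob)
  have GmHom: "Gm g \<in> Hom C (Go X) (Go Y)" if "X \<in> Ob D" "Y \<in> Ob D" "g \<in> Hom D X Y" for X Y g
    using that by (simp flip: Hom add: GoOb)
  have "cat_functor C D Fo (\<lambda>_ _. Fm)"
    by unfold_locales (simp_all add: Ob Hom Id Comp)
  moreover have "cat_functor D C Go (\<lambda>_ _. Gm)"
    by unfold_locales (auto simp: GoOb GmHom Id Comp intro!: inj)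
  ultimately show ?thesis
    unfolding isomorphic_categories_def
    by (intro exI[of _ Fo] exI[of _ "\<lambda>_ _. Fm"] exI[of _ Go] exI[of _ "\<lambda>_ _. Gm"]) simp
qed

section \<open>Finite sums of morphisms\<close>

context preadditive_category
begin

lemma comm_monoid_hom: "\<lbrakk>X \<in> Ob C; Y \<in> Ob C\<rbrakk> \<Longrightarrow> comm_monoid (hom_group C X Y)"
  using comm_group_hom by (simp add: comm_group_def)

lemma hom_group_simps [simp]:
  "carrier (hom_group C X Y) = Hom C X Y"
  "mult (hom_group C X Y) = Add C X Y"
  "one (hom_group C X Y) = Zero C X Y"
  by (simp_all add: hom_group_def)

lemma Zero_in_Hom: "\<lbrakk>X \<in> Ob C; Y \<in> Ob C\<rbrakk> \<Longrightarrow> Zero C X Y \<in> Hom C X Y"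
  using monoid.one_closed[OF comm_monoid.axioms(1)[OF comm_monoid_hom]] by simp

lemma Add_Zero_self_iff:
  assumes "X \<in> Ob C" "Y \<in> Ob C" "f \<in> Hom C X Y" "Add C X Y f f = f"
  shows "f = Zero C X Y"
proof -
  interpret comm_group "hom_group C X Y" using assms by (simp add: comm_group_hom)
  show ?thesis using l_cancel_one[of f f] assms by simp
qed

lemma Add_Zero_Zero: "\<lbrakk>X \<in> Ob C; Y \<in> Ob C\<rbrakk> \<Longrightarrow> Add C X Y (Zero C X Y) (Zero C X Y) = Zero C X Y"
  using monoid.l_one[OF comm_monoid.axioms(1)[OF comm_monoid_hom], of X Y "Zero C X Y"]
  by (simp add: Zero_in_Hom)

lemma Comp_Zero_right:
  assumes "X \<in> Ob C" "Y \<in> Ob C" "Z \<in> Ob C" "g \<in> Hom C Y Z"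
  shows "Comp C X Y Z g (Zero C X Y) = Zero C X Z"
  using assms Comp_Add_right[of X Y Z "Zero C X Y" "Zero C X Y" g]
  by (intro Add_Zero_self_iff) (simp_all add: Comp_in_Hom Zero_in_Hom Add_Zero_Zero)

lemma Comp_Zero_left:
  assumes "X \<in> Ob C" "Y \<in> Ob C" "Z \<in> Ob C" "f \<in> Hom C X Y"
  shows "Comp C X Y Z (Zero C Y Z) f = Zero C X Z"
  using assms Comp_Add_left[of X Y Z f "Zero C Y Z" "Zero C Y Z"]
  by (intro Add_Zero_self_iff) (simp_all add: Comp_in_Hom Zero_in_Hom Add_Zero_Zero)

lemma hom_sum_0:
  "\<lbrakk>X \<in> Ob C; Y \<in> Ob C; t 0 \<in> Hom C X Y\<rbrakk> \<Longrightarrow> hom_sum C X Y t 0 = t 0"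
  using comm_monoid.finprod_0[OF comm_monoid_hom, of X Y t] by (simp add: hom_sum_def)

lemma hom_sum_Suc:
  "\<lbrakk>X \<in> Ob C; Y \<in> Ob C; \<And>k. k \<le> Suc n \<Longrightarrow> t k \<in> Hom C X Y\<rbrakk>
    \<Longrightarrow> hom_sum C X Y t (Suc n) = Add C X Y (t (Suc n)) (hom_sum C X Y t n)"
  using comm_monoid.finprod_Suc[OF comm_monoid_hom, of X Y t n] by (simp add: hom_sum_def Pi_def)

lemma hom_sum_in_Hom:
  "\<lbrakk>X \<in> Ob C; Y \<in> Ob C; \<And>k. k \<le> n \<Longrightarrow> t k \<in> Hom C X Y\<rbrakk> \<Longrightarrow> hom_sum C X Y t n \<in> Hom C X Y"
  using comm_monoid.finprod_closed[OF comm_monoid_hom, of X Y t "{..n}"]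
  by (simp add: hom_sum_def Pi_def)

lemma hom_sum_cong:
  assumes "X \<in> Ob C" "Y \<in> Ob C"
    and "\<And>k. k \<le> n \<Longrightarrow> t k = u k" "\<And>k. k \<le> n \<Longrightarrow> u k \<in> Hom C X Y"
  shows "hom_sum C X Y t n = hom_sum C X Y u n"
  using assms comm_monoid.finprod_cong'[OF comm_monoid_hom, of X Y "{..n}" "{..n}" u t]
  by (simp add: hom_sum_def Pi_def)

lemma hom_sum_Add:
  assumes "X \<in> Ob C" "Y \<in> Ob C"
    and "\<And>k. k \<le> n \<Longrightarrow> t k \<in> Hom C X Y" "\<And>k. k \<le> n \<Longrightarrow> u k \<in> Hom C X Y"
  shows "hom_sum C X Y (\<lambda>k. Add C X Y (t k) (u k)) n
    = Add C X Y (hom_sum C X Y t n) (hom_sum C X Y u n)"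
  using assms comm_monoid.finprod_multf[OF comm_monoid_hom, of X Y t "{..n}" u]
  by (simp add: hom_sum_def Pi_def)

lemma hom_sum_reflect:
  assumes "X \<in> Ob C" "Y \<in> Ob C" "\<And>k. k \<le> n \<Longrightarrow> t k \<in> Hom C X Y"
  shows "hom_sum C X Y (\<lambda>k. t (n - k)) n = hom_sum C X Y t n"
proof -
  have im: "(\<lambda>k. n - k) ` {..n} = {..n}"
    by (metis (no_types, lifting) atMost_iff diff_diff_cancel diff_le_self image_eqI image_subsetI
        subsetI subset_antisym)
  have "inj_on (\<lambda>k. n - k) {..n}"
    by (auto simp: inj_on_def)
  then show ?thesis
    using assms comm_monoid.finprod_reindex[OF comm_monoid_hom, of X Y t "\<lambda>k. n - k" "{..n}"]
    unfolding im by (simp add: hom_sum_def Pi_def)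
qed

lemma hom_sum_single:
  assumes "X \<in> Ob C" "Y \<in> Ob C" "i \<le> n" "f \<in> Hom C X Y"
  shows "hom_sum C X Y (\<lambda>k. if k = i then f else Zero C X Y) n = f"
  using assms comm_monoid.finprod_singleton[OF comm_monoid_hom, of X Y i "{..n}" "\<lambda>_. f"]
  unfolding hom_sum_def hom_group_simps by (simp add: Pi_def eq_commute[of i])

lemma Comp_hom_sum_right:
  assumes "X \<in> Ob C" "Y \<in> Ob C" "Z \<in> Ob C" "g \<in> Hom C Y Z"
  shows "(\<And>k. k \<le> n \<Longrightarrow> t k \<in> Hom C X Y) \<Longrightarrow>
    Comp C X Y Z g (hom_sum C X Y t n) = hom_sum C X Z (\<lambda>k. Comp C X Y Z g (t k)) n"
  using assms
  by (induction n) (simp_all add: hom_sum_0 hom_sum_Suc Comp_in_Hom Comp_Add_right hom_sum_in_Hom)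

lemma Comp_hom_sum_left:
  assumes "X \<in> Ob C" "Y \<in> Ob C" "Z \<in> Ob C" "f \<in> Hom C X Y"
  shows "(\<And>k. k \<le> n \<Longrightarrow> t k \<in> Hom C Y Z) \<Longrightarrow>
    Comp C X Y Z (hom_sum C Y Z t n) f = hom_sum C X Z (\<lambda>k. Comp C X Y Z (t k) f) n"
  using assms
  by (induction n) (simp_all add: hom_sum_0 hom_sum_Suc Comp_in_Hom Comp_Add_left hom_sum_in_Hom)

text \<open>
  Both sides sum \<open>T\<close> over the triangle \<open>l \<le> k \<le> n\<close>; enlarging \<open>n\<close> adds the same row to each.
\<close>

lemma hom_sum_triangle:
  assumes "X \<in> Ob C" "Y \<in> Ob C"
  shows "(\<And>k l. l \<le> k \<Longrightarrow> k \<le> n \<Longrightarrow> T k l \<in> Hom C X Y) \<Longrightarrow>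
    hom_sum C X Y (\<lambda>k. hom_sum C X Y (T k) k) n
    = hom_sum C X Y (\<lambda>l. hom_sum C X Y (\<lambda>m. T (l + m) l) (n - l)) n"
proof (induction n)
  case 0
  then show ?case using assms by (simp add: hom_sum_0)
next
  case (Suc n)
  interpret comm_monoid "hom_group C X Y" using assms by (rule comm_monoid_hom)
  let ?S = "hom_sum C X Y"
  let ?L = "\<lambda>n l. ?S (\<lambda>m. T (l + m) l) (n - l)"
  have L: "?L N l \<in> Hom C X Y" if "l \<le> N" "N \<le> Suc n" for N l
    using that assms Suc.prems by (intro hom_sum_in_Hom) auto
  have "?S (?L (Suc n)) n = ?S (\<lambda>l. Add C X Y (T (Suc n) l) (?L n l)) n"
  proof (rule hom_sum_cong)
    fix l assume "l \<le> n"
    then show "?L (Suc n) l = Add C X Y (T (Suc n) l) (?L n l)"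
      using assms Suc.prems by (simp add: Suc_diff_le hom_sum_Suc)
    show "Add C X Y (T (Suc n) l) (?L n l) \<in> Hom C X Y"
      using m_closed[of "T (Suc n) l" "?L n l"] L[of l n] Suc.prems \<open>l \<le> n\<close> by simp
  qed (use assms in auto)
  also have "\<dots> = Add C X Y (?S (T (Suc n)) n) (?S (?L n) n)"
    using assms Suc.prems L by (intro hom_sum_Add) auto
  finally have row: "?S (?L (Suc n)) n = \<dots>" .
  have "?S (\<lambda>k. ?S (T k) k) (Suc n) = Add C X Y (?S (T (Suc n)) (Suc n)) (?S (\<lambda>k. ?S (T k) k) n)"
    using assms Suc.prems by (intro hom_sum_Suc hom_sum_in_Hom) auto
  also have "?S (T (Suc n)) (Suc n) = Add C X Y (T (Suc n) (Suc n)) (?S (T (Suc n)) n)"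
    using assms Suc.prems by (intro hom_sum_Suc) auto
  also have "?S (\<lambda>k. ?S (T k) k) n = ?S (?L n) n"
    using Suc by simp
  also have "Add C X Y (Add C X Y (T (Suc n) (Suc n)) (?S (T (Suc n)) n)) (?S (?L n) n)
    = Add C X Y (T (Suc n) (Suc n)) (?S (?L (Suc n)) n)"
    unfolding row
    using m_assoc[of "T (Suc n) (Suc n)" "?S (T (Suc n)) n" "?S (?L n) n"] assms Suc.prems L
    by (simp add: hom_sum_in_Hom)
  also have "\<dots> = ?S (?L (Suc n)) (Suc n)"
    using assms Suc.prems L by (simp add: hom_sum_Suc hom_sum_0)
  finally show ?case .
qed

end

section \<open>The category of graded objects and complexes over it\<close>

lemma Zplus_simps:
  "X \<in> Ob (Zplus A) \<longleftrightarrow> (\<forall>j. X j \<in> Ob A)"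
  "f \<in> Hom (Zplus A) X Y \<longleftrightarrow> (\<forall>n j. f n j \<in> Hom A (X j) (Y (j + int n)))"
  "Id (Zplus A) X n j = (if n = 0 then Id A (X j) else Zero A (X j) (X (j + int n)))"
  "Zero (Zplus A) X Y n j = Zero A (X j) (Y (j + int n))"
  "Comp (Zplus A) X Y Z g f n j = hom_sum A (X j) (Z (j + int n))
     (\<lambda>k. Comp A (X j) (Y (j + int k)) (Z (j + int n)) (g (n - k) (j + int k)) (f k j)) n"
  by (simp_all add: Zplus_def)

lemma add_int_diff: "k \<le> n \<Longrightarrow> j + int k + int (n - k) = j + int n"
  by simp

context preadditive_category
begin

lemma Zplus_component_in_Hom:
  assumes "f \<in> Hom (Zplus C) X Y" "i = j + int n"
  shows "f n j \<in> Hom C (X j) (Y i)"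
  using assms by (simp add: Zplus_simps)

lemma Zplus_summand_in_Hom:
  assumes "X \<in> Ob (Zplus C)" "Y \<in> Ob (Zplus C)" "Z \<in> Ob (Zplus C)"
    and "f \<in> Hom (Zplus C) X Y" "g \<in> Hom (Zplus C) Y Z" "k \<le> n"
  shows "Comp C (X j) (Y (j + int k)) (Z (j + int n)) (g (n - k) (j + int k)) (f k j)
    \<in> Hom C (X j) (Z (j + int n))"
  using assms
  by (intro Comp_in_Hom) (simp_all add: Zplus_component_in_Hom, simp_all add: Zplus_simps)

lemma category_Zplus: "category (Zplus C)"
proof
  fix X Y Z f g
  assume "X \<in> Ob (Zplus C)" "Y \<in> Ob (Zplus C)" "Z \<in> Ob (Zplus C)"
    "f \<in> Hom (Zplus C) X Y" "g \<in> Hom (Zplus C) Y Z"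
  then have "hom_sum C (X j) (Z (j + int n))
      (\<lambda>k. Comp C (X j) (Y (j + int k)) (Z (j + int n)) (g (n - k) (j + int k)) (f k j)) n
    \<in> Hom C (X j) (Z (j + int n))" for n j
    by (intro hom_sum_in_Hom Zplus_summand_in_Hom) (auto simp: Zplus_simps(1))
  then show "Comp (Zplus C) X Y Z g f \<in> Hom (Zplus C) X Z"
    by (subst Zplus_simps(2)) (simp add: Zplus_simps(5))
next
  fix X assume "X \<in> Ob (Zplus C)"
  then show "Id (Zplus C) X \<in> Hom (Zplus C) X X"
    by (simp add: Zplus_simps Id_in_Hom Zero_in_Hom)
next
  fix X Y f assume *: "X \<in> Ob (Zplus C)" "Y \<in> Ob (Zplus C)" "f \<in> Hom (Zplus C) X Y"
  show "Comp (Zplus C) X X Y f (Id (Zplus C) X) = f"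
  proof (intro ext)
    fix n j
    have Ob: "X i \<in> Ob C" "Y i \<in> Ob C" for i using * by (simp_all add: Zplus_simps)
    have f: "f m i \<in> Hom C (X i) (Y i')" if "i' = i + int m" for m i i'
      using *(3) that by (rule Zplus_component_in_Hom)
    have "Comp (Zplus C) X X Y f (Id (Zplus C) X) n j
      = hom_sum C (X j) (Y (j + int n)) (\<lambda>k. if k = 0 then f n j else Zero C (X j) (Y (j + int n))) n"
      unfolding Zplus_simps(5)
      by (rule hom_sum_cong)
        (auto simp: Ob f Zero_in_Hom Zplus_simps(3) Comp_Id Comp_Zero_right)
    then show "Comp (Zplus C) X X Y f (Id (Zplus C) X) n j = f n j"
      by (simp add: hom_sum_single Ob f)
  qed
next
  fix X Y f assume *: "X \<in> Ob (Zplus C)" "Y \<in> Ob (Zplus C)" "f \<in> Hom (Zplus C) X Y"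
  show "Comp (Zplus C) X Y Y (Id (Zplus C) Y) f = f"
  proof (intro ext)
    fix n j
    have Ob: "X i \<in> Ob C" "Y i \<in> Ob C" for i using * by (simp_all add: Zplus_simps)
    have f: "f m i \<in> Hom C (X i) (Y i')" if "i' = i + int m" for m i i'
      using *(3) that by (rule Zplus_component_in_Hom)
    have "Comp (Zplus C) X Y Y (Id (Zplus C) Y) f n j
      = hom_sum C (X j) (Y (j + int n)) (\<lambda>k. if k = n then f n j else Zero C (X j) (Y (j + int n))) n"
      unfolding Zplus_simps(5)
      by (rule hom_sum_cong)
        (auto simp: Ob f Zero_in_Hom Zplus_simps(3) Id_Comp Comp_Zero_left add_int_diff)
    then show "Comp (Zplus C) X Y Y (Id (Zplus C) Y) f n j = f n j"
      by (simp add: hom_sum_single Ob f)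
  qed
next
  fix W X Y Z f g h
  assume Ob': "W \<in> Ob (Zplus C)" "X \<in> Ob (Zplus C)" "Y \<in> Ob (Zplus C)" "Z \<in> Ob (Zplus C)"
    and Hom': "f \<in> Hom (Zplus C) W X" "g \<in> Hom (Zplus C) X Y" "h \<in> Hom (Zplus C) Y Z"
  have Ob: "W i \<in> Ob C" "X i \<in> Ob C" "Y i \<in> Ob C" "Z i \<in> Ob C" for i
    using Ob' by (simp_all add: Zplus_simps)
  have f: "f m i \<in> Hom C (W i) (X i')" and g: "g m i \<in> Hom C (X i) (Y i')"
    and h: "h m i \<in> Hom C (Y i) (Z i')" if "i' = i + int m" for m i i'
    using Hom' that by (simp_all add: Zplus_component_in_Hom)
  show "Comp (Zplus C) W Y Z h (Comp (Zplus C) W X Y g f)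
    = Comp (Zplus C) W X Z (Comp (Zplus C) X Y Z h g) f"
  proof (intro ext)
    fix n j
    let ?S = "hom_sum C (W j) (Z (j + int n))"
    \<comment> \<open>the summand in which \<open>f\<close>, \<open>g\<close>, \<open>h\<close> have degrees \<open>l\<close>, \<open>k - l\<close>, \<open>n - k\<close>\<close>
    let ?T = "\<lambda>k l. Comp C (W j) (Y (j + int k)) (Z (j + int n)) (h (n - k) (j + int k))
      (Comp C (W j) (X (j + int l)) (Y (j + int k)) (g (k - l) (j + int l)) (f l j))"
    have gf: "Comp C (W j) (X (j + int l)) (Y (j + int k)) (g (k - l) (j + int l)) (f l j)
      \<in> Hom C (W j) (Y (j + int k))" if "l \<le> k" for k l
      using Ob' Hom' that by (intro Zplus_summand_in_Hom) auto
    have hg: "Comp C (X (j + int l)) (Y (j + int (l + m))) (Z (j + int n))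
        (h (n - (l + m)) (j + int (l + m))) (g m (j + int l))
      \<in> Hom C (X (j + int l)) (Z (j + int n))" if "l + m \<le> n" for l m
      using that by (intro Comp_in_Hom Ob g h) auto
    have T: "?T k l \<in> Hom C (W j) (Z (j + int n))" if "l \<le> k" "k \<le> n" for k l
      using that by (intro Comp_in_Hom[of "W j" "Y (j + int k)"] gf h Ob) auto
    have "Comp (Zplus C) W Y Z h (Comp (Zplus C) W X Y g f) n j = ?S (\<lambda>k. ?S (?T k) k) n"
      unfolding Zplus_simps(5)
    proof (rule hom_sum_cong)
      fix k assume "k \<le> n"
      then show "Comp C (W j) (Y (j + int k)) (Z (j + int n)) (h (n - k) (j + int k))
          (hom_sum C (W j) (Y (j + int k)) (\<lambda>l. Comp C (W j) (X (j + int l)) (Y (j + int k))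
            (g (k - l) (j + int l)) (f l j)) k) = ?S (?T k) k"
        by (intro Comp_hom_sum_right Ob h gf) auto
      show "?S (?T k) k \<in> Hom C (W j) (Z (j + int n))"
        using \<open>k \<le> n\<close> by (intro hom_sum_in_Hom Ob T)
    qed (simp_all add: Ob)
    also have "\<dots> = ?S (\<lambda>l. ?S (\<lambda>m. ?T (l + m) l) (n - l)) n"
      by (intro hom_sum_triangle Ob T)
    also have "\<dots> = Comp (Zplus C) W X Z (Comp (Zplus C) X Y Z h g) f n j"
      unfolding Zplus_simps(5)
    proof (rule hom_sum_cong[symmetric])
      fix l assume l: "l \<le> n"
      have "Comp C (W j) (X (j + int l)) (Z (j + int n))
          (hom_sum C (X (j + int l)) (Z (j + int l + int (n - l)))
            (\<lambda>m. Comp C (X (j + int l)) (Y (j + int l + int m)) (Z (j + int l + int (n - l)))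
              (h (n - l - m) (j + int l + int m)) (g m (j + int l))) (n - l)) (f l j)
        = Comp C (W j) (X (j + int l)) (Z (j + int n))
          (hom_sum C (X (j + int l)) (Z (j + int n))
            (\<lambda>m. Comp C (X (j + int l)) (Y (j + int (l + m))) (Z (j + int n))
              (h (n - (l + m)) (j + int (l + m))) (g m (j + int l))) (n - l)) (f l j)"
        unfolding add_int_diff[OF l] by (simp only: diff_diff_left of_nat_add add.assoc)
      also have "\<dots> = ?S (\<lambda>m. Comp C (W j) (X (j + int l)) (Z (j + int n))
          (Comp C (X (j + int l)) (Y (j + int (l + m))) (Z (j + int n))
              (h (n - (l + m)) (j + int (l + m))) (g m (j + int l))) (f l j)) (n - l)"
        using l by (intro Comp_hom_sum_left Ob f hg) auto
      also have "\<dots> = ?S (\<lambda>m. ?T (l + m) l) (n - l)"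
      proof (rule hom_sum_cong)
        fix m assume m: "m \<le> n - l"
        show "?T (l + m) l \<in> Hom C (W j) (Z (j + int n))"
          using l m by (intro T) auto
        have "g m (j + int l) \<in> Hom C (X (j + int l)) (Y (j + int (l + m)))"
          "h (n - (l + m)) (j + int (l + m)) \<in> Hom C (Y (j + int (l + m))) (Z (j + int n))"
          using l m by (intro g h; simp)+
        then show "Comp C (W j) (X (j + int l)) (Z (j + int n))
          (Comp C (X (j + int l)) (Y (j + int (l + m))) (Z (j + int n))
              (h (n - (l + m)) (j + int (l + m))) (g m (j + int l))) (f l j) = ?T (l + m) l"
          by (simp add: Comp_assoc Ob f del: of_nat_add)
      qed (simp_all add: Ob)
      finally show "Comp C (W j) (X (j + int l)) (Z (j + int n))
          (hom_sum C (X (j + int l)) (Z (j + int l + int (n - l)))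
            (\<lambda>m. Comp C (X (j + int l)) (Y (j + int l + int m)) (Z (j + int l + int (n - l)))
              (h (n - l - m) (j + int l + int m)) (g m (j + int l))) (n - l)) (f l j)
        = ?S (\<lambda>m. ?T (l + m) l) (n - l)" .
      show "?S (\<lambda>m. ?T (l + m) l) (n - l) \<in> Hom C (W j) (Z (j + int n))"
        using l by (intro hom_sum_in_Hom Ob T) auto
    qed (simp_all add: Ob)
    finally show "Comp (Zplus C) W Y Z h (Comp (Zplus C) W X Y g f) n j
      = Comp (Zplus C) W X Z (Comp (Zplus C) X Y Z h g) f n j" .
  qed
qed

end

lemma Cplx_cat_simps:
  "(X, d) \<in> Ob (Cplx_cat B) \<longleftrightarrow> (\<forall>i. X i \<in> Ob B) \<and> (\<forall>i. d i \<in> Hom B (X i) (X (i + 1))) \<and>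
    (\<forall>i. Comp B (X i) (X (i + 1)) (X (i + 2)) (d (i + 1)) (d i) = Zero B (X i) (X (i + 2)))"
  "f \<in> Hom (Cplx_cat B) (X, dX) (Y, dY) \<longleftrightarrow> (\<forall>i. f i \<in> Hom B (X i) (Y i)) \<and>
    (\<forall>i. Comp B (X i) (X (i + 1)) (Y (i + 1)) (f (i + 1)) (dX i)
       = Comp B (X i) (Y i) (Y (i + 1)) (dY i) (f i))"
  "Comp (Cplx_cat B) (X, dX) (Y, dY) (Z, dZ) g f = (\<lambda>i. Comp B (X i) (Y i) (Z i) (g i) (f i))"
  "Id (Cplx_cat B) (X, d) = (\<lambda>i. Id B (X i))"
  by (auto simp: Cplx_cat_def)

text \<open>
  The axioms are inherited degreewise from \<open>B\<close>; only the commutation of composites with the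
  differentials is not literally an instance of an axiom of \<open>B\<close>.
\<close>

lemma category_Cplx_cat:
  assumes "category B"
  shows "category (Cplx_cat B)"
proof -
  interpret B: category B by (fact assms)
  show ?thesis
  proof
    fix X Y Z :: "('a, 'b) cplx" and f g :: "int \<Rightarrow> 'b"
    assume "X \<in> Ob (Cplx_cat B)" "Y \<in> Ob (Cplx_cat B)" "Z \<in> Ob (Cplx_cat B)"
      "f \<in> Hom (Cplx_cat B) X Y" "g \<in> Hom (Cplx_cat B) Y Z"
    then show "Comp (Cplx_cat B) X Y Z g f \<in> Hom (Cplx_cat B) X Z"
    proof (cases X; cases Y; cases Z; clarify)
      fix X dX Y dY Z dZ
      assume "(X, dX) \<in> Ob (Cplx_cat B)" "(Y, dY) \<in> Ob (Cplx_cat B)" "(Z, dZ) \<in> Ob (Cplx_cat B)"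
        "f \<in> Hom (Cplx_cat B) (X, dX) (Y, dY)" "g \<in> Hom (Cplx_cat B) (Y, dY) (Z, dZ)"
      note * = this[unfolded Cplx_cat_simps]
      have "Comp B (X i) (X (i + 1)) (Z (i + 1))
          (Comp B (X (i + 1)) (Y (i + 1)) (Z (i + 1)) (g (i + 1)) (f (i + 1))) (dX i)
        = Comp B (X i) (Z i) (Z (i + 1)) (dZ i) (Comp B (X i) (Y i) (Z i) (g i) (f i))" for i
      proof -
        have "Comp B (X i) (X (i + 1)) (Z (i + 1))
            (Comp B (X (i + 1)) (Y (i + 1)) (Z (i + 1)) (g (i + 1)) (f (i + 1))) (dX i)
          = Comp B (X i) (Y (i + 1)) (Z (i + 1)) (g (i + 1))
              (Comp B (X i) (X (i + 1)) (Y (i + 1)) (f (i + 1)) (dX i))"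
          using * by (intro B.Comp_assoc[symmetric]) auto
        also have "\<dots> = Comp B (X i) (Y (i + 1)) (Z (i + 1)) (g (i + 1))
              (Comp B (X i) (Y i) (Y (i + 1)) (dY i) (f i))"
          using * by simp
        also have "\<dots> = Comp B (X i) (Y i) (Z (i + 1))
              (Comp B (Y i) (Y (i + 1)) (Z (i + 1)) (g (i + 1)) (dY i)) (f i)"
          using * by (intro B.Comp_assoc) auto
        also have "\<dots> = Comp B (X i) (Y i) (Z (i + 1))
              (Comp B (Y i) (Z i) (Z (i + 1)) (dZ i) (g i)) (f i)"
          using * by simp
        also have "\<dots> = Comp B (X i) (Z i) (Z (i + 1)) (dZ i) (Comp B (X i) (Y i) (Z i) (g i) (f i))"
          using * by (intro B.Comp_assoc[symmetric]) auto
        finally show ?thesis .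
      qed
      then show "Comp (Cplx_cat B) (X, dX) (Y, dY) (Z, dZ) g f
          \<in> Hom (Cplx_cat B) (X, dX) (Z, dZ)"
        using * by (simp add: Cplx_cat_simps B.Comp_in_Hom)
    qed
  qed (auto simp: Cplx_cat_simps B.Id_in_Hom B.Comp_Id B.Id_Comp B.Comp_assoc)
qed

section \<open>Bigraded objects by total degree\<close>

definition obj_by_total_degree :: "(int \<Rightarrow> int \<Rightarrow> 'o) \<Rightarrow> int \<Rightarrow> int \<Rightarrow> 'o" where
  "obj_by_total_degree X i j = X (i - j) j"

definition mor_by_total_degree :: "'m G_mor \<Rightarrow> int \<Rightarrow> nat \<Rightarrow> int \<Rightarrow> 'm" where
  "mor_by_total_degree a i n j = a n (i - j) j"

definition G_obj_by_total_degree ::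
  "('o, 'm) G_obj \<Rightarrow> (int \<Rightarrow> 'o, nat \<Rightarrow> int \<Rightarrow> 'm) cplx" where
  "G_obj_by_total_degree = (\<lambda>(X, d). (obj_by_total_degree X, mor_by_total_degree d))"

lemma bij_mor_by_total_degree: "bij mor_by_total_degree"
  by (rule o_bij[where g = "\<lambda>b n p q. b (p + q) n q"])
    (auto simp: mor_by_total_degree_def fun_eq_iff)

lemma bij_G_obj_by_total_degree: "bij G_obj_by_total_degree"
  by (rule o_bij[where g = "\<lambda>(X, d). (\<lambda>p q. X (p + q) q, \<lambda>n p q. d (p + q) n q)"])
    (auto simp: G_obj_by_total_degree_def mor_by_total_degree_def obj_by_total_degree_def fun_eq_iff)

lemma all_bidegrees_iff: "(\<forall>p q. P p q) \<longleftrightarrow> (\<forall>i j. P (i - j) j)" for P :: "int \<Rightarrow> int \<Rightarrow> bool"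
  by (metis add_diff_cancel_right')

lemma Ob_by_total_degree:
  "(\<forall>i. obj_by_total_degree X i \<in> Ob (Zplus A)) \<longleftrightarrow> (\<forall>p q. X p q \<in> Ob A)"
  by (subst all_bidegrees_iff) (simp add: Zplus_simps obj_by_total_degree_def)

lemma Hom_by_total_degree:
  "(\<forall>i. mor_by_total_degree a i
      \<in> Hom (Zplus A) (obj_by_total_degree X i) (obj_by_total_degree Y (i + s)))
    \<longleftrightarrow> (\<forall>n p q. a n p q \<in> Hom A (X p q) (Y (p + s - int n) (q + int n)))"
  (is "_ \<longleftrightarrow> (\<forall>n. ?P n)")
proof -
  have "?P n \<longleftrightarrow> (\<forall>i j. a n (i - j) j \<in> Hom A (X (i - j) j) (Y (i + s - (j + int n)) (j + int n)))"
    for n by (subst all_bidegrees_iff) (simp add: algebra_simps)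
  then show ?thesis
    by (auto simp: Zplus_simps mor_by_total_degree_def obj_by_total_degree_def)
qed

text \<open>
  The convolutions in \<open>G(A)\<close> for maps of bidegrees \<open>(s - n, n)\<close> and \<open>(t - n, n)\<close>.  The cases
  \<open>(s, t) = (1, 1)\<close>, \<open>(1, 0)\<close>, \<open>(0, 1)\<close> and \<open>(0, 0)\<close> give \<open>d\<^sup>2\<close>, \<open>\<alpha>d\<close>, \<open>d\<alpha>\<close> and the composition of
  morphisms.  The sum in \<open>\<int>\<^sub>+A\<close> is indexed by the degree of the inner factor, the one in \<open>G(A)\<close>
  by that of the outer factor, so one of them has to be reversed.
\<close>

lemma (in preadditive_category) Comp_Zplus_by_total_degree:
  assumes Ob: "\<And>p q. X p q \<in> Ob C" "\<And>p q. Y p q \<in> Ob C" "\<And>p q. Z p q \<in> Ob C"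
    and b: "\<And>n p q. b n p q \<in> Hom C (X p q) (Y (p + s - int n) (q + int n))"
    and a: "\<And>n p q. a n p q \<in> Hom C (Y p q) (Z (p + t - int n) (q + int n))"
  shows "Comp (Zplus C) (obj_by_total_degree X (p + q)) (obj_by_total_degree Y (p + q + s))
      (obj_by_total_degree Z (p + q + s + t))
      (mor_by_total_degree a (p + q + s)) (mor_by_total_degree b (p + q)) n q
    = hom_sum C (X p q) (Z (p + s + t - int n) (q + int n))
      (\<lambda>k. Comp C (X p q) (Y (p + s - int (n - k)) (q + int (n - k)))
              (Z (p + s + t - int n) (q + int n))
              (a k (p + s - int (n - k)) (q + int (n - k))) (b (n - k) p q)) n"
proof -
  let ?u = "\<lambda>k. Comp C (X p q) (Y (p + s - int k) (q + int k))
    (Z (p + s + t - int n) (q + int n)) (a (n - k) (p + s - int k) (q + int k)) (b k p q)"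
  have u: "?u k \<in> Hom C (X p q) (Z (p + s + t - int n) (q + int n))" if "k \<le> n" for k
  proof (rule Comp_in_Hom[OF Ob b])
    show "a (n - k) (p + s - int k) (q + int k)
      \<in> Hom C (Y (p + s - int k) (q + int k)) (Z (p + s + t - int n) (q + int n))"
      using a[of "n - k" "p + s - int k" "q + int k"] that by (simp add: algebra_simps)
  qed
  have "hom_sum C (X p q) (Z (p + s + t - int n) (q + int n)) ?u n
    = hom_sum C (X p q) (Z (p + s + t - int n) (q + int n)) (\<lambda>k. ?u (n - k)) n"
    using Ob u by (intro hom_sum_reflect[symmetric]) auto
  also have "\<dots> = hom_sum C (X p q) (Z (p + s + t - int n) (q + int n))
      (\<lambda>k. Comp C (X p q) (Y (p + s - int (n - k)) (q + int (n - k)))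
              (Z (p + s + t - int n) (q + int n))
              (a k (p + s - int (n - k)) (q + int (n - k))) (b (n - k) p q)) n"
  proof (rule hom_sum_cong)
    fix k assume "k \<le> n"
    then show "Comp C (X p q) (Y (p + s - int (n - k)) (q + int (n - k)))
              (Z (p + s + t - int n) (q + int n))
              (a k (p + s - int (n - k)) (q + int (n - k))) (b (n - k) p q)
      \<in> Hom C (X p q) (Z (p + s + t - int n) (q + int n))"
      using u[of "n - k"] by simp
  qed (simp_all add: Ob)
  finally show ?thesis
    by (simp add: Zplus_simps obj_by_total_degree_def mor_by_total_degree_def algebra_simps)
qed

section \<open>The isomorphism\<close>

lemma G_cat_simps:
  "Ob (G_cat A) = G_Ob A" "Hom (G_cat A) = G_Hom A"
  "Comp (G_cat A) = G_Comp A" "Id (G_cat A) = G_Id A"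
  by (simp_all add: G_cat_def)

text \<open>
  A relation in \<open>\<int>\<^sub>+A\<close> required in every total degree becomes, through this equivalence, the
  family of relations over all bidegrees by which \<open>G(A)\<close> is defined.
\<close>

lemma all_degrees_eq_iff:
  "(\<forall>i. F i = G i) \<longleftrightarrow> (\<forall>n p q. F (p + q) n q = G (p + q) n q)"
  for F G :: "int \<Rightarrow> nat \<Rightarrow> int \<Rightarrow> 'm"
proof
  assume R: "\<forall>n p q. F (p + q) n q = G (p + q) n q"
  show "\<forall>i. F i = G i"
  proof (intro allI ext)
    fix i n j
    show "F i n j = G i n j" using R[rule_format, of "i - j" j n] by simp
  qed
qed simp

context preadditive_category
begin

lemma G_obj_by_total_degree_in_Ob_iff:
  "G_obj_by_total_degree Xd \<in> Ob (Cplx_cat (Zplus C)) \<longleftrightarrow> Xd \<in> Ob (G_cat C)"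
proof (cases Xd)
  case (Pair X d)
  let ?X = "obj_by_total_degree X" and ?d = "mor_by_total_degree d"
  show ?thesis
  \<comment> \<open>the convolution formula only applies to components lying in the right hom-sets; if one
    does not, membership fails on both sides\<close>
  proof (cases "(\<forall>p q. X p q \<in> Ob C) \<and>
      (\<forall>n p q. d n p q \<in> Hom C (X p q) (X (p + 1 - int n) (q + int n)))")
    case True
    have "Comp (Zplus C) (?X (p + q)) (?X (p + q + 1)) (?X (p + q + 2)) (?d (p + q + 1)) (?d (p + q)) n q
      = hom_sum C (X p q) (X (p + 2 - int n) (q + int n))
        (\<lambda>k. Comp C (X p q) (X (p + 1 - int (n - k)) (q + int (n - k)))
                (X (p + 2 - int n) (q + int n))
                (d k (p + 1 - int (n - k)) (q + int (n - k))) (d (n - k) p q)) n" for n p q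
      using Comp_Zplus_by_total_degree[of X X X d 1 d 1 p q n] True by (simp add: add.assoc)
    moreover have "Zero (Zplus C) (?X (p + q)) (?X (p + q + 2)) n q
      = Zero C (X p q) (X (p + 2 - int n) (q + int n))" for n p q
      by (simp add: Zplus_simps obj_by_total_degree_def algebra_simps)
    ultimately show ?thesis
      using True Hom_by_total_degree[of d C X X 1] Ob_by_total_degree[of X C]
      by (simp add: Pair G_obj_by_total_degree_def Cplx_cat_simps G_cat_simps G_Ob_def
        all_degrees_eq_iff[where F = "\<lambda>i. Comp (Zplus C) (?X i) (?X (i + 1)) (?X (i + 2)) (?d (i + 1)) (?d i)"])
  next
    case False
    then show ?thesis
      using Hom_by_total_degree[of d C X X 1] Ob_by_total_degree[of X C]
      by (auto simp: Pair G_obj_by_total_degree_def Cplx_cat_simps G_cat_simps G_Ob_def)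
  qed
qed

lemma mor_by_total_degree_in_Hom_iff:
  assumes "Xd \<in> Ob (G_cat C)" "Yd \<in> Ob (G_cat C)"
  shows "mor_by_total_degree f
      \<in> Hom (Cplx_cat (Zplus C)) (G_obj_by_total_degree Xd) (G_obj_by_total_degree Yd)
    \<longleftrightarrow> f \<in> Hom (G_cat C) Xd Yd"
proof -
  obtain X dX Y dY where XY: "Xd = (X, dX)" "Yd = (Y, dY)"
    by fastforce
  have Ob: "X p q \<in> Ob C" "Y p q \<in> Ob C"
    and d: "dX n p q \<in> Hom C (X p q) (X (p + 1 - int n) (q + int n))"
      "dY n p q \<in> Hom C (Y p q) (Y (p + 1 - int n) (q + int n))" for n p q
    using assms by (auto simp: XY G_cat_simps G_Ob_def)
  let ?X = "obj_by_total_degree X" and ?dX = "mor_by_total_degree dX"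
  let ?Y = "obj_by_total_degree Y" and ?dY = "mor_by_total_degree dY"
  let ?f = "mor_by_total_degree f"
  show ?thesis
  proof (cases "\<forall>n p q. f n p q \<in> Hom C (X p q) (Y (p - int n) (q + int n))")
    case True
    have "Comp (Zplus C) (?X (p + q)) (?X (p + q + 1)) (?Y (p + q + 1)) (?f (p + q + 1)) (?dX (p + q)) n q
      = hom_sum C (X p q) (Y (p + 1 - int n) (q + int n))
        (\<lambda>k. Comp C (X p q) (X (p + 1 - int (n - k)) (q + int (n - k)))
                (Y (p + 1 - int n) (q + int n))
                (f k (p + 1 - int (n - k)) (q + int (n - k))) (dX (n - k) p q)) n" for n p q
      using Comp_Zplus_by_total_degree[of X X Y dX 1 f 0 p q n] True Ob d by simp
    moreover have "Comp (Zplus C) (?X (p + q)) (?Y (p + q)) (?Y (p + q + 1)) (?dY (p + q)) (?f (p + q)) n q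
      = hom_sum C (X p q) (Y (p + 1 - int n) (q + int n))
        (\<lambda>k. Comp C (X p q) (Y (p - int (n - k)) (q + int (n - k)))
                (Y (p + 1 - int n) (q + int n))
                (dY k (p - int (n - k)) (q + int (n - k))) (f (n - k) p q)) n" for n p q
      using Comp_Zplus_by_total_degree[of X Y Y f 0 dY 1 p q n] True Ob d by simp
    ultimately show ?thesis
      using True Hom_by_total_degree[of f C X Y 0]
      by (simp add: XY G_obj_by_total_degree_def Cplx_cat_simps G_cat_simps G_Hom_def
        all_degrees_eq_iff[where F = "\<lambda>i. Comp (Zplus C) (?X i) (?X (i + 1)) (?Y (i + 1)) (?f (i + 1)) (?dX i)"])
  next
    case False
    then show ?thesis
      using Hom_by_total_degree[of f C X Y 0]
      by (auto simp: XY G_obj_by_total_degree_def Cplx_cat_simps G_cat_simps G_Hom_def)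
  qed
qed

lemma mor_by_total_degree_Id:
  "mor_by_total_degree (Id (G_cat C) Xd) = Id (Cplx_cat (Zplus C)) (G_obj_by_total_degree Xd)"
  by (cases Xd) (auto simp: fun_eq_iff G_obj_by_total_degree_def mor_by_total_degree_def
    obj_by_total_degree_def Cplx_cat_simps G_cat_simps G_Id_def Zplus_simps algebra_simps)

lemma mor_by_total_degree_Comp:
  assumes "Xd \<in> Ob (G_cat C)" "Yd \<in> Ob (G_cat C)" "Zd \<in> Ob (G_cat C)"
    and "f \<in> Hom (G_cat C) Xd Yd" "g \<in> Hom (G_cat C) Yd Zd"
  shows "mor_by_total_degree (Comp (G_cat C) Xd Yd Zd g f)
    = Comp (Cplx_cat (Zplus C)) (G_obj_by_total_degree Xd) (G_obj_by_total_degree Yd)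
        (G_obj_by_total_degree Zd) (mor_by_total_degree g) (mor_by_total_degree f)"
proof -
  obtain X dX Y dY Z dZ where XYZ: "Xd = (X, dX)" "Yd = (Y, dY)" "Zd = (Z, dZ)"
    by (metis surj_pair)
  have Ob: "X p q \<in> Ob C" "Y p q \<in> Ob C" "Z p q \<in> Ob C"
    and Hom: "f n p q \<in> Hom C (X p q) (Y (p - int n) (q + int n))"
      "g n p q \<in> Hom C (Y p q) (Z (p - int n) (q + int n))" for n p q
    using assms by (auto simp: XYZ G_cat_simps G_Ob_def G_Hom_def)
  let ?X = "obj_by_total_degree X" and ?Y = "obj_by_total_degree Y"
  let ?Z = "obj_by_total_degree Z"
  let ?gf = "\<lambda>i. Comp (Zplus C) (?X i) (?Y i) (?Z i) (mor_by_total_degree g i) (mor_by_total_degree f i)"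
  have "?gf (p + q) n q = G_Comp C Xd Yd Zd g f n p q" for n p q
    using Comp_Zplus_by_total_degree[of X Y Z f 0 g 0 p q n] Ob Hom
    by (simp add: XYZ G_Comp_def)
  then have "\<forall>i. mor_by_total_degree (G_Comp C Xd Yd Zd g f) i = ?gf i"
    by (subst all_degrees_eq_iff) (simp add: mor_by_total_degree_def)
  then show ?thesis
    by (auto simp: XYZ G_obj_by_total_degree_def Cplx_cat_simps G_cat_simps)
qed

end

theorem proposition4p4:
  fixes A :: "('o, 'm, 'z) ab_cat_scheme"
  assumes "additive_category A"
  shows "isomorphic_categories (G_cat A) (Cplx_cat (Zplus A))"
proof -
  interpret additive_category A by (fact assms)
  show ?thesis
    by (rule isomorphic_categories_relabelling
        [where Fo = G_obj_by_total_degree and Fm = mor_by_total_degree])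
      (simp_all add: category_Cplx_cat category_Zplus bij_G_obj_by_total_degree
        bij_mor_by_total_degree G_obj_by_total_degree_in_Ob_iff mor_by_total_degree_in_Hom_iff
        mor_by_total_degree_Id mor_by_total_degree_Comp)
qed

end
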